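(* Let $G$ be a finite CSA group. Then $G$ is abelian.
   Context: A subgroup $H$ of a group $G$ is malnormal in $G$ if $g^{-1}Hg \cap H = \{1\}$ for every $g \in G \setminus H$. A group $G$ is CSA (conjugately separated abelian) if every maximal abelian subgroup of $G$ is malnormal in $G$. *)

theory Defs
  imports "HOL-Algebra.Algebra"
begin

definition malnormal :: "'a set \<Rightarrow> ('a, 'b) monoid_scheme \<Rightarrow> bool" where
  "malnormal H G \<longleftrightarrow> subgroup H G \<and>
     (\<forall>g \<in> carrier G - H.
        (\<lambda>h. inv\<^bsub>G\<^esub> g \<otimes>\<^bsub>G\<^esub> h \<otimes>\<^bsub>G\<^esub> g) ` H \<inter> H = {\<one>\<^bsub>G\<^esub>})"

definition abelian_subgroup :: "'a set \<Rightarrow> ('a, 'b) monoid_scheme \<Rightarrow> bool" where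
  "abelian_subgroup H G \<longleftrightarrow> subgroup H G \<and> comm_group (G\<lparr>carrier := H\<rparr>)"

(* Maximality is with respect to inclusion among all abelian subgroups;
   the whole group is allowed when it is itself abelian. *)
definition maximal_abelian_subgroup :: "'a set \<Rightarrow> ('a, 'b) monoid_scheme \<Rightarrow> bool" where
  "maximal_abelian_subgroup H G \<longleftrightarrow> abelian_subgroup H G \<and>
     (\<forall>K. abelian_subgroup K G \<longrightarrow> H \<subseteq> K \<longrightarrow> K = H)"

definition CSA_group :: "('a, 'b) monoid_scheme \<Rightarrow> bool" where
  "CSA_group G \<longleftrightarrow> group G \<and>
     (\<forall>H. maximal_abelian_subgroup H G \<longrightarrow> malnormal H G)"

end

theory Submission
  imports Defs
begin

text \<open>
  The proof is a count of conjugates.  Let \<open>H\<close> be a nontrivial malnormal subgroup of a finite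
  group \<open>G\<close>.  An element \<open>y \<noteq> \<one>\<close> that is conjugate into \<open>H\<close> is carried into \<open>H\<close> by exactly one
  right coset of \<open>H\<close>, so the set \<open>U\<close> of all such \<open>y\<close> satisfies
  \<open>\<bar>U\<bar> = [G : H] (\<bar>H\<bar> - 1) = \<bar>G\<bar> - [G : H]\<close> (\<open>malnormal_conjugates_card\<close>).  Hence \<open>U\<close> contains at
  least half of the elements of \<open>G\<close>, but, if \<open>H\<close> is proper, it misses some \<open>y \<noteq> \<one>\<close>.

  Suppose now that \<open>G\<close> is CSA but not abelian.  Every element lies in a maximal abelian subgroup,
  and every such subgroup is proper and malnormal.  Let \<open>A\<close> be a maximal abelian subgroup containing
  some \<open>x \<noteq> \<one>\<close>, and \<open>B\<close> one containing some \<open>y \<noteq> \<one>\<close> that is not conjugate into \<open>A\<close>.  No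
  nontrivial element is conjugate into both \<open>A\<close> and \<open>B\<close>: since a malnormal subgroup contains the
  centralizers of its nontrivial elements, the abelian group \<open>B\<close>, and with it \<open>y\<close>, would be conjugate
  into \<open>A\<close> (\<open>malnormal_abelian_conjugates_disjoint\<close>).  So \<open>G - {\<one>}\<close> contains two
  disjoint sets of at least \<open>\<bar>G\<bar> / 2\<close> elements each, which is impossible.
\<close>

section \<open>Conjugates of a malnormal subgroup\<close>

definition nontrivial_conjugates :: "'a set \<Rightarrow> ('a, 'b) monoid_scheme \<Rightarrow> 'a set" where
  "nontrivial_conjugates H G =
     (\<lambda>(g, h). inv\<^bsub>G\<^esub> g \<otimes>\<^bsub>G\<^esub> h \<otimes>\<^bsub>G\<^esub> g) ` (carrier G \<times> (H - {\<one>\<^bsub>G\<^esub>}))"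

context group
begin

lemma mult_inv_cancel_left:
  assumes "g \<in> carrier G" "x \<in> carrier G"
  shows "g \<otimes> (inv g \<otimes> x) = x" "inv g \<otimes> (g \<otimes> x) = x"
  using assms by (simp_all add: m_assoc[symmetric])

lemma conj_eq_iff:
  assumes "g \<in> carrier G" "h \<in> carrier G" "y \<in> carrier G"
  shows "inv g \<otimes> h \<otimes> g = y \<longleftrightarrow> h = g \<otimes> y \<otimes> inv g"
proof
  assume "inv g \<otimes> h \<otimes> g = y"
  then have "g \<otimes> y \<otimes> inv g = g \<otimes> (inv g \<otimes> h \<otimes> g) \<otimes> inv g" by simp
  also have "\<dots> = h" using assms by (simp add: m_assoc mult_inv_cancel_left)
  finally show "h = g \<otimes> y \<otimes> inv g" by simp
next
  assume "h = g \<otimes> y \<otimes> inv g"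
  then show "inv g \<otimes> h \<otimes> g = y"
    using assms by (simp add: m_assoc mult_inv_cancel_left)
qed

lemma conj_eq_one_iff:
  assumes "g \<in> carrier G" "h \<in> carrier G"
  shows "inv g \<otimes> h \<otimes> g = \<one> \<longleftrightarrow> h = \<one>"
  using assms by (simp add: conj_eq_iff)

lemma malnormal_conj_mem:
  assumes "malnormal H G" "k \<in> carrier G" "h \<in> H" "inv k \<otimes> h \<otimes> k \<in> H" "h \<noteq> \<one>"
  shows "k \<in> H"
proof (rule ccontr)
  assume "k \<notin> H"
  with assms have "inv k \<otimes> h \<otimes> k = \<one>"
    unfolding malnormal_def by blast
  moreover have "h \<in> carrier G"
    using assms by (auto simp: malnormal_def dest: subgroup.mem_carrier)
  ultimately show False using assms conj_eq_one_iff by blast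
qed

text \<open>An element that fixes \<open>h \<in> H\<close> under conjugation does not move \<open>h\<close> out of \<open>H\<close>.\<close>

lemma malnormal_centralizer:
  assumes "malnormal H G" "h \<in> H" "h \<noteq> \<one>" "k \<in> carrier G" "h \<otimes> k = k \<otimes> h"
  shows "k \<in> H"
proof (rule malnormal_conj_mem[OF assms(1,4,2) _ assms(3)])
  have "h \<in> carrier G"
    using assms by (auto simp: malnormal_def dest: subgroup.mem_carrier)
  then have "inv k \<otimes> h \<otimes> k = h"
    using assms by (simp add: m_assoc mult_inv_cancel_left)
  then show "inv k \<otimes> h \<otimes> k \<in> H" using assms(2) by simp
qed

lemma nontrivial_conjugates_subset:
  assumes "subgroup H G"
  shows "nontrivial_conjugates H G \<subseteq> carrier G - {\<one>}"
  using subgroup.mem_carrier[OF assms]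
  by (auto simp: nontrivial_conjugates_def conj_eq_one_iff)

text \<open>Two conjugations carrying the same nontrivial element into \<open>H\<close> differ by an element of \<open>H\<close>;
  conversely every element of \<open>H\<close> gives such a change of conjugation.\<close>

lemma malnormal_conj_fibre_card:
  assumes mal: "malnormal H G" and y: "y \<in> nontrivial_conjugates H G"
  shows "card {p \<in> carrier G \<times> (H - {\<one>}). (case p of (g, h) \<Rightarrow> inv g \<otimes> h \<otimes> g) = y} = card H"
proof -
  have H: "subgroup H G" using mal by (simp add: malnormal_def)
  note HG = subgroup.mem_carrier[OF H]
  obtain g0 h0 where g0: "g0 \<in> carrier G" and h0: "h0 \<in> H" "h0 \<noteq> \<one>"
    and y_eq: "y = inv g0 \<otimes> h0 \<otimes> g0"
    using y by (auto simp: nontrivial_conjugates_def)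
  have yG: "y \<in> carrier G" using g0 h0 HG y_eq by simp
  have h0_eq: "h0 = g0 \<otimes> y \<otimes> inv g0"
    using conj_eq_iff[OF g0 HG[OF h0(1)] yG] y_eq by simp
  have h_iff: "inv g \<otimes> h \<otimes> g = y \<longleftrightarrow> h = (g \<otimes> inv g0) \<otimes> h0 \<otimes> inv (g \<otimes> inv g0)"
    if "g \<in> carrier G" "h \<in> carrier G" for g h
    using that g0 yG unfolding conj_eq_iff[OF that yG] h0_eq
    by (simp add: m_assoc inv_mult_group mult_inv_cancel_left)
  let ?F = "{p \<in> carrier G \<times> (H - {\<one>}). (case p of (g, h) \<Rightarrow> inv g \<otimes> h \<otimes> g) = y}"
  have "bij_betw (\<lambda>k. (k \<otimes> g0, k \<otimes> h0 \<otimes> inv k)) H ?F"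
  proof (rule bij_betwI')
    fix k l assume "k \<in> H" "l \<in> H"
    then show "((k \<otimes> g0, k \<otimes> h0 \<otimes> inv k) = (l \<otimes> g0, l \<otimes> h0 \<otimes> inv l)) = (k = l)"
      using g0 HG by auto
  next
    fix k assume k: "k \<in> H"
    let ?h = "k \<otimes> h0 \<otimes> inv k"
    have hH: "?h \<in> H"
      using k h0 H by (simp add: subgroup.m_closed subgroup.m_inv_closed)
    have "inv k \<otimes> ?h \<otimes> k = h0"
      using conj_eq_iff[OF HG[OF k] HG[OF hH] HG[OF h0(1)]] by simp
    then have "?h \<noteq> \<one>"
      using h0(2) conj_eq_one_iff[OF HG[OF k] HG[OF hH]] by auto
    moreover have "k \<otimes> g0 \<otimes> inv g0 = k"
      using HG[OF k] g0 by (simp add: m_assoc)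
    ultimately show "(k \<otimes> g0, ?h) \<in> ?F"
      using h_iff[of "k \<otimes> g0" ?h] HG[OF hH] HG[OF k] g0 hH by simp
  next
    fix p assume "p \<in> ?F"
    then obtain g h where p: "p = (g, h)" and gh: "g \<in> carrier G" "h \<in> H" "h \<noteq> \<one>"
      "inv g \<otimes> h \<otimes> g = y" by auto
    let ?k = "g \<otimes> inv g0"
    have kG: "?k \<in> carrier G" using gh g0 by simp
    have h_eq: "h = ?k \<otimes> h0 \<otimes> inv ?k" using h_iff gh HG by blast
    then have "inv ?k \<otimes> h \<otimes> ?k = h0"
      using conj_eq_iff[OF kG HG[OF gh(2)] HG[OF h0(1)]] by simp
    then have "?k \<in> H"
      using malnormal_conj_mem[OF mal kG gh(2) _ gh(3)] h0 by simp
    moreover have "?k \<otimes> g0 = g" using gh g0 by (simp add: m_assoc)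
    ultimately show "\<exists>k\<in>H. p = (k \<otimes> g0, k \<otimes> h0 \<otimes> inv k)"
      using p h_eq by metis
  qed
  then show ?thesis by (simp add: bij_betw_same_card)
qed

text \<open>Counting the pairs \<open>(g, h)\<close> by the conjugate that they produce.  The product form avoids the
  division in \<open>[G : H] (\<bar>H\<bar> - 1)\<close>.\<close>

lemma malnormal_conjugates_card:
  assumes fin: "finite (carrier G)" and mal: "malnormal H G"
  shows "card (nontrivial_conjugates H G) * card H = order G * (card H - 1)"
proof -
  have H: "subgroup H G" using mal by (simp add: malnormal_def)
  have finH: "finite H" using H fin by (meson finite_subset subgroup.subset)
  let ?S = "carrier G \<times> (H - {\<one>})"
  let ?c = "\<lambda>(g, h). inv g \<otimes> h \<otimes> g"
  have "card ?S = (\<Sum>y\<in>?c ` ?S. card {p \<in> ?S. ?c p = y})"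
    using sum.image_gen[of ?S "\<lambda>_. 1::nat" ?c] fin finH by simp
  also have "\<dots> = (\<Sum>y\<in>nontrivial_conjugates H G. card H)"
    unfolding nontrivial_conjugates_def[symmetric]
    by (rule sum.cong[OF refl malnormal_conj_fibre_card[OF mal]])
  finally show ?thesis
    using finH subgroup.one_closed[OF H] by (simp add: order_def card_cartesian_product)
qed

lemma malnormal_conjugates_half:
  assumes fin: "finite (carrier G)" and mal: "malnormal H G" and nontriv: "H \<noteq> {\<one>}"
  shows "order G \<le> 2 * card (nontrivial_conjugates H G)"
proof -
  have H: "subgroup H G" using mal by (simp add: malnormal_def)
  have finH: "finite H" using H fin by (meson finite_subset subgroup.subset)
  have "card H > 0" using finH subgroup.one_closed[OF H] by (auto simp: card_gt_0_iff)
  moreover have "card H \<noteq> 1"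
    using nontriv subgroup.one_closed[OF H] by (auto simp: card_1_singleton_iff)
  ultimately have "card H \<le> 2 * (card H - 1)" by simp
  then have "order G * card H \<le> order G * (2 * (card H - 1))" by (rule mult_le_mono2)
  also have "\<dots> = 2 * card (nontrivial_conjugates H G) * card H"
    using malnormal_conjugates_card[OF fin mal] by simp
  finally show ?thesis using \<open>card H > 0\<close> by simp
qed

text \<open>The conjugates of \<open>H\<close> leave out \<open>[G : H] - 1\<close> nontrivial elements.\<close>

lemma malnormal_conjugates_omit:
  assumes fin: "finite (carrier G)" and mal: "malnormal H G" and proper: "H \<noteq> carrier G"
  obtains y where "y \<in> carrier G" "y \<noteq> \<one>" "y \<notin> nontrivial_conjugates H G"
proof -
  have H: "subgroup H G" using mal by (simp add: malnormal_def)
  have finH: "finite H" using H fin by (meson finite_subset subgroup.subset)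
  have pos: "card H > 0" using finH subgroup.one_closed[OF H] by (auto simp: card_gt_0_iff)
  have lt: "card H < order G"
    unfolding order_def using H proper fin by (intro psubset_card_mono) (auto dest: subgroup.mem_carrier)
  have "nontrivial_conjugates H G \<noteq> carrier G - {\<one>}"
  proof
    assume "nontrivial_conjugates H G = carrier G - {\<one>}"
    then have "card (nontrivial_conjugates H G) = order G - 1"
      using fin by (simp add: order_def)
    then have "(order G - 1) * card H = order G * (card H - 1)"
      using malnormal_conjugates_card[OF fin mal] by simp
    then have "order G * card H - card H = order G * card H - order G"
      by (simp add: diff_mult_distrib diff_mult_distrib2)
    moreover have "order G \<le> order G * card H" using pos by simp
    ultimately show False using lt by linarith
  qed
  then show ?thesis using nontrivial_conjugates_subset[OF H] that by blast
qed

text \<open>If a nontrivial element is conjugate into both subgroups, then some conjugate \<open>k B k\<^sup>-\<^sup>1\<close>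
  meets \<open>A\<close> in an element \<open>a \<noteq> \<one>\<close>.  As \<open>B\<close> is abelian, \<open>a\<close> commutes with all of \<open>k B k\<^sup>-\<^sup>1\<close>, so \<open>A\<close>
  contains this conjugate, and in particular \<open>k y k\<^sup>-\<^sup>1\<close>, against the choice of \<open>y\<close>.\<close>

lemma malnormal_abelian_conjugates_disjoint:
  assumes mal: "malnormal A G" and B: "subgroup B G"
    and comm: "\<And>b c. b \<in> B \<Longrightarrow> c \<in> B \<Longrightarrow> b \<otimes> c = c \<otimes> b"
    and y: "y \<in> B" "y \<noteq> \<one>" "y \<notin> nontrivial_conjugates A G"
  shows "nontrivial_conjugates A G \<inter> nontrivial_conjugates B G = {}"
proof (rule ccontr)
  assume "\<not> ?thesis"
  then obtain g a h b where g: "g \<in> carrier G" and a: "a \<in> A" "a \<noteq> \<one>"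
    and h: "h \<in> carrier G" and b: "b \<in> B" "b \<noteq> \<one>"
    and eq: "inv g \<otimes> a \<otimes> g = inv h \<otimes> b \<otimes> h"
    by (fastforce simp: nontrivial_conjugates_def)
  have A: "subgroup A G" using mal by (simp add: malnormal_def)
  have aG: "a \<in> carrier G" and bG: "b \<in> carrier G" and yG: "y \<in> carrier G"
    using a b y A B by (auto dest: subgroup.mem_carrier)
  let ?k = "g \<otimes> inv h"
  have kG: "?k \<in> carrier G" using g h by simp
  have a_eq: "a = ?k \<otimes> b \<otimes> inv ?k"
    using conj_eq_iff[OF g aG, of "inv h \<otimes> b \<otimes> h"] eq g h bG by (simp add: m_assoc inv_mult_group)
  let ?z = "?k \<otimes> y \<otimes> inv ?k"
  have zG: "?z \<in> carrier G" using kG yG by simp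
  have conj_mult: "(?k \<otimes> u \<otimes> inv ?k) \<otimes> (?k \<otimes> v \<otimes> inv ?k) = ?k \<otimes> (u \<otimes> v) \<otimes> inv ?k"
    if "u \<in> carrier G" "v \<in> carrier G" for u v
    using kG that by (simp only: m_assoc m_closed inv_closed mult_inv_cancel_left)
  have "a \<otimes> ?z = ?z \<otimes> a"
    unfolding a_eq conj_mult[OF bG yG] conj_mult[OF yG bG] comm[OF b(1) y(1)] ..
  then have "?z \<in> A" by (rule malnormal_centralizer[OF mal a zG])
  moreover have y_eq: "inv ?k \<otimes> ?z \<otimes> ?k = y" using conj_eq_iff[OF kG zG yG] by blast
  moreover have "?z \<noteq> \<one>" using conj_eq_one_iff[OF kG zG] y_eq y(2) by auto
  ultimately have "y \<in> nontrivial_conjugates A G"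
    unfolding nontrivial_conjugates_def using kG by force
  then show False using y(3) by simp
qed

section \<open>Maximal abelian subgroups\<close>

lemma abelian_subgroup_commute:
  assumes "abelian_subgroup H G" "x \<in> H" "y \<in> H"
  shows "x \<otimes> y = y \<otimes> x"
  using assms comm_monoid.m_comm[of "G\<lparr>carrier := H\<rparr>" x y]
  by (simp add: abelian_subgroup_def comm_group_def)

lemma abelian_subgroup_cyclic:
  assumes x: "x \<in> carrier G"
  shows "abelian_subgroup (generate G {x}) G"
proof -
  have sub: "subgroup (generate G {x}) G" using x by (intro generate_is_subgroup) simp
  have "a \<otimes> b = b \<otimes> a" if "a \<in> generate G {x}" "b \<in> generate G {x}" for a b
    using that x by (auto simp: generate_pow int_pow_mult[symmetric] add.commute)
  then have "comm_group (G\<lparr>carrier := generate G {x}\<rparr>)"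
    by (intro group.group_comm_groupI subgroup.subgroup_is_group[OF sub]) (auto intro: is_group)
  then show ?thesis using sub by (simp add: abelian_subgroup_def)
qed

lemma exists_maximal_abelian_subgroup:
  assumes fin: "finite (carrier G)" and x: "x \<in> carrier G"
  obtains H where "maximal_abelian_subgroup H G" "x \<in> H"
proof -
  let ?C = "{H. abelian_subgroup H G}"
  have "?C \<subseteq> Pow (carrier G)" by (auto simp: abelian_subgroup_def dest: subgroup.mem_carrier)
  then have "finite ?C" using fin by (meson finite_Pow_iff finite_subset)
  then obtain H where "H \<in> ?C" "generate G {x} \<subseteq> H" "\<forall>K\<in>?C. H \<subseteq> K \<longrightarrow> H = K"
    using finite_has_maximal2[of ?C "generate G {x}"] abelian_subgroup_cyclic[OF x] by auto
  moreover have "x \<in> generate G {x}" by (simp add: generate.incl)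
  ultimately show ?thesis by (intro that[of H]) (auto simp: maximal_abelian_subgroup_def)
qed

end

section \<open>Finite CSA groups\<close>

theorem theorem3p5:
  fixes G :: "('a, 'b) monoid_scheme"
  assumes "CSA_group G"
    and "finite (carrier G)"
  shows "comm_group G"
proof (rule ccontr)
  assume nonab: "\<not> comm_group G"
  interpret group G using assms(1) by (simp add: CSA_group_def)
  note fin = assms(2)
  have mal: "malnormal H G" if "maximal_abelian_subgroup H G" for H
    using assms(1) that by (simp add: CSA_group_def)
  obtain x where x: "x \<in> carrier G" "x \<noteq> \<one>\<^bsub>G\<^esub>"
    using nonab group_comm_groupI by (metis one_closed)
  obtain A where A: "maximal_abelian_subgroup A G" "x \<in> A"
    using exists_maximal_abelian_subgroup[OF fin x(1)] .
  have "A \<noteq> carrier G"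
    using A(1) nonab by (auto simp: maximal_abelian_subgroup_def abelian_subgroup_def)
  then obtain y where y: "y \<in> carrier G" "y \<noteq> \<one>\<^bsub>G\<^esub>" "y \<notin> nontrivial_conjugates A G"
    using malnormal_conjugates_omit[OF fin mal[OF A(1)]] by blast
  obtain B where B: "maximal_abelian_subgroup B G" "y \<in> B"
    using exists_maximal_abelian_subgroup[OF fin y(1)] .
  have subA: "subgroup A G" and subB: "subgroup B G" and abB: "abelian_subgroup B G"
    using A(1) B(1) by (auto simp: maximal_abelian_subgroup_def abelian_subgroup_def)
  let ?U = "nontrivial_conjugates A G" and ?V = "nontrivial_conjugates B G"
  have disj: "?U \<inter> ?V = {}"
    using malnormal_abelian_conjugates_disjoint[OF mal[OF A(1)] subB
        abelian_subgroup_commute[OF abB] B(2) y(2,3)] .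
  have sub: "?U \<subseteq> carrier G - {\<one>\<^bsub>G\<^esub>}" "?V \<subseteq> carrier G - {\<one>\<^bsub>G\<^esub>}"
    using nontrivial_conjugates_subset subA subB by blast+
  have "card ?U + card ?V = card (?U \<union> ?V)"
    using sub fin disj by (intro card_Un_disjoint[symmetric]) (auto intro: finite_subset)
  also have "\<dots> \<le> card (carrier G - {\<one>\<^bsub>G\<^esub>})"
    using sub fin by (intro card_mono) auto
  also have "\<dots> < order G"
    unfolding order_def using fin by (intro psubset_card_mono) auto
  finally have "card ?U + card ?V < order G" .
  moreover have "order G \<le> 2 * card ?U"
    using malnormal_conjugates_half[OF fin mal[OF A(1)]] A(2) x(2) by blast
  moreover have "order G \<le> 2 * card ?V"
    using malnormal_conjugates_half[OF fin mal[OF B(1)]] B(2) y(2) by blast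
  ultimately show False by linarith
qed

end
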